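(* Let $X$ and $Y$ be patterned matrices whose link functions $L_1$ and $L_2$ are any two of the following five: Wigner, Toeplitz, Hankel, Symmetric Circulant, Reverse Circulant, and suppose that all input variables (of both matrices) are independent real random variables with mean $0$, variance $1$ and, for every $m$, uniformly bounded $m$-th absolute moments. Then for every monomial $q$ in $X$ and $Y$, of length $k$ say, and for every $w\in CW(2)$ corresponding to $q$, the limit $$p_C(w)=\lim_{n\to\infty}\frac{1}{n^{1+k/2}}|\Pi_C^*(w)|$$ exists.
   Context: A patterned matrix with (symmetric) link function $L:\{1,\dots,n\}^2\to\mathbb Z^d$ ($d=1$ or $2$; dependence on $n$ suppressed) and input sequence $\{x(t)\}$ of real random variables is the $n\times n$ real symmetric matrix with $(i,j)$ entry $x(L(i,j))$. The five link functions are: Wigner $L(i,j)=(\min(i,j),\max(i,j))$; Toeplitz $L(i,j)=|i-j|$; Hankel $L(i,j)=i+j$; Reverse Circulant $L(i,j)=(i+j)\bmod n$; Symmetric Circulant $L(i,j)=n/2-|n/2-|i-j||$. Let $q=Z_{c_1}Z_{c_2}\cdots Z_{c_k}$ be a monomial, where $c_i\in\{1,2\}$ is the color of position $i$, $Z_1=X$, $Z_2=Y$. $CW(2)$ is the set of colored pair-matched words corresponding to $q$: words $w=w[1]\cdots w[k]$ (up to renaming of letters) in which each letter appears exactly twice and $w[i]=w[j]$ implies $c_i=c_j$. A circuit is a map $\pi:\{0,1,\dots,k\}\to\{1,\dots,n\}$ with $\pi(0)=\pi(k)$, and $$\Pi_C^*(w)=\{\pi \text{ circuit}: w[i]=w[j]\Rightarrow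 c_i=c_j \text{ and } L_{c_i}(\pi(i-1),\pi(i))=L_{c_j}(\pi(j-1),\pi(j))\}.$$ *)

theory Defs
  imports "HOL-Probability.Probability" "Jordan_Normal_Form.Matrix"
begin

text \<open>An element of \<open>\<int>\<^sup>d\<close> is a list of \<open>d\<close> integers. The first argument of a link function is the
  dimension \<open>n\<close>; only its values on \<open>{1..n} \<times> {1..n}\<close> matter.\<close>

type_synonym link = "nat \<Rightarrow> nat \<Rightarrow> nat \<Rightarrow> int list"

definition wigner_link :: link where
  "wigner_link n i j = [int (min i j), int (max i j)]"

definition toeplitz_link :: link where
  "toeplitz_link n i j = [\<bar>int i - int j\<bar>]"

definition hankel_link :: link where
  "hankel_link n i j = [int (i + j)]"

definition reverse_circulant_link :: link where
  "reverse_circulant_link n i j = [int ((i + j) mod n)]"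

text \<open>The real number under the floor is always an integer (lemma below); the floor only
  changes its type.\<close>

definition symmetric_circulant_link :: link where
  "symmetric_circulant_link n i j =
     [\<lfloor>real n / 2 - \<bar>real n / 2 - \<bar>real i - real j\<bar>\<bar>\<rfloor>]"

lemma symmetric_circulant_integral:
  "real n / 2 - \<bar>real n / 2 - \<bar>real i - real j\<bar>\<bar> \<in> \<int>"
proof -
  have "real n / 2 - \<bar>real n / 2 - \<bar>real i - real j\<bar>\<bar> =
      of_int (min \<bar>int i - int j\<bar> (int n - \<bar>int i - int j\<bar>))"
    by (auto simp: min_def abs_if)
  then show ?thesis by (metis Ints_of_int)
qed

definition five_links :: "link set" where
  "five_links = {wigner_link, toeplitz_link, hankel_link,
     symmetric_circulant_link, reverse_circulant_link}"

text \<open>The indices of those input variables that occur in the matrices of some size \<open>n\<close>. For the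
  Wigner link these are the pairs \<open>[i, j]\<close> with \<open>1 \<le> i \<le> j\<close>.\<close>

definition link_indices :: "link \<Rightarrow> int list set" where
  "link_indices L = {L n i j | n i j. i \<in> {1..n} \<and> j \<in> {1..n}}"

text \<open>Matrices are indexed from \<open>0\<close> in the library, hence the shift by one.\<close>

definition patterned_matrix ::
  "link \<Rightarrow> (int list \<Rightarrow> 'a \<Rightarrow> real) \<Rightarrow> nat \<Rightarrow> 'a \<Rightarrow> real mat" where
  "patterned_matrix L x n \<omega> = mat n n (\<lambda>(i, j). x (L n (i + 1) (j + 1)) \<omega>)"

text \<open>All input variables of both matrices; \<open>(c, t)\<close> stands for the variable with index \<open>t\<close> of
  the matrix with color \<open>c\<close>.\<close>

definition input_indices :: "(nat \<Rightarrow> link) \<Rightarrow> (nat \<times> int list) set" where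
  "input_indices L = (SIGMA c:{1, 2}. link_indices (L c))"

definition admissible_inputs ::
  "'a measure \<Rightarrow> (nat \<Rightarrow> link) \<Rightarrow> (nat \<Rightarrow> int list \<Rightarrow> 'a \<Rightarrow> real) \<Rightarrow> bool" where
  "admissible_inputs M L x \<longleftrightarrow>
     prob_space.indep_vars M (\<lambda>_. borel) (\<lambda>(c, t). x c t) (input_indices L) \<and>
     (\<forall>(c, t)\<in>input_indices L.
        prob_space.expectation M (x c t) = 0 \<and> prob_space.variance M (x c t) = 1) \<and>
     (\<forall>m::nat. \<exists>K::real. \<forall>(c, t)\<in>input_indices L.
        integrable M (\<lambda>\<omega>. \<bar>x c t \<omega>\<bar> ^ m) \<and>
        prob_space.expectation M (\<lambda>\<omega>. \<bar>x c t \<omega>\<bar> ^ m) \<le> K)"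

text \<open>A monomial is given by its list of colors. Lists are indexed from \<open>0\<close>, so position \<open>i\<close> of
  a monomial or of a word is entry \<open>i - 1\<close> of the list. Words are represented by their
  individual spellings, with natural numbers as letters; \<open>Pi_C_star\<close> below does not change under
  renaming of letters.\<close>

definition monomials :: "nat list set" where
  "monomials = {c. set c \<subseteq> {1, 2}}"

definition CW2 :: "nat list \<Rightarrow> nat list set" where
  "CW2 c = {w. length w = length c \<and>
     (\<forall>a\<in>set w. card {i \<in> {1..length w}. w ! (i - 1) = a} = 2) \<and>
     (\<forall>i\<in>{1..length w}. \<forall>j\<in>{1..length w}. w ! (i - 1) = w ! (j - 1) \<longrightarrow> c ! (i - 1) = c ! (j - 1))}"

definition circuits :: "nat \<Rightarrow> nat \<Rightarrow> (nat \<Rightarrow> nat) set" where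
  "circuits k n = {\<pi> \<in> {0..k} \<rightarrow>\<^sub>E {1..n}. \<pi> 0 = \<pi> k}"

definition Pi_C_star ::
  "(nat \<Rightarrow> link) \<Rightarrow> nat list \<Rightarrow> nat list \<Rightarrow> nat \<Rightarrow> (nat \<Rightarrow> nat) set" where
  "Pi_C_star L c w n = {\<pi> \<in> circuits (length c) n.
     \<forall>i\<in>{1..length c}. \<forall>j\<in>{1..length c}. w ! (i - 1) = w ! (j - 1) \<longrightarrow>
       c ! (i - 1) = c ! (j - 1) \<and>
       L (c ! (i - 1)) n (\<pi> (i - 1)) (\<pi> i) = L (c ! (j - 1)) n (\<pi> (j - 1)) (\<pi> j)}"

end

theory Submission
  imports Defs
begin

text \<open>
  For each of the five links, \<open>L n a b = L n c d\<close> is a disjunction of linear equations over the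
  integers, homogeneous in \<open>(a, b, c, d, n)\<close>, in which \<open>d\<close> has coefficient \<open>\<plusminus>1\<close>. Hence at
  the second occurrence \<open>j\<close> of a letter, \<open>\<pi> j\<close> takes one of finitely many values that are
  integer linear forms in \<open>n\<close> and the earlier values of \<open>\<pi>\<close>. Eliminating these positions from right to
  left leaves \<open>1 + k/2\<close> free positions, subject to a Boolean combination of sign conditions on integer
  linear forms in \<open>(\<pi>, n)\<close>; the closing condition \<open>\<pi> 0 = \<pi> k\<close> and the second Wigner equation
  are among them. As the dependent values are integer combinations of the free ones, no divisibility
  condition arises. By homogeneity the conditions only concern \<open>\<pi> / n\<close>, so the number of solutions
  divided by \<open>n\<close> to the number of free positions tends to the volume of a region in the unit cube
  bounded by finitely many hyperplanes.
\<close>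

section \<open>Integer linear forms and Boolean combinations of their sign conditions\<close>

text \<open>There is no constant term: the dimension \<open>n\<close> acts as one more homogeneous
  variable. Dividing by \<open>n\<close> therefore turns a form in \<open>p\<close> and
  \<open>n\<close> into an affine function of \<open>p / n\<close> that no longer depends on
  \<open>n\<close>.\<close>

definition lin :: "'i set \<Rightarrow> (('i \<Rightarrow> int) \<Rightarrow> nat \<Rightarrow> int) \<Rightarrow> bool" where
  "lin V l \<longleftrightarrow> (\<exists>a b. \<forall>p n. l p n = (\<Sum>i\<in>V. a i * p i) + b * int n)"

lemma linI: "(\<And>p n. l p n = (\<Sum>i\<in>V. a i * p i) + b * int n) \<Longrightarrow> lin V l"
  unfolding lin_def by blast

lemma lin_cong: "lin V l \<Longrightarrow> (\<And>i. i \<in> V \<Longrightarrow> p i = q i) \<Longrightarrow> l p n = l q n"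
  unfolding lin_def by auto

lemma lin_zero: "lin V (\<lambda>p n. 0)"
  by (rule linI[where a = "\<lambda>_. 0" and b = 0]) simp

lemma lin_size: "lin V (\<lambda>p n. int n)"
  by (rule linI[where a = "\<lambda>_. 0" and b = 1]) simp

lemma lin_var: "finite V \<Longrightarrow> i \<in> V \<Longrightarrow> lin V (\<lambda>p n. p i)"
  by (rule linI[where a = "\<lambda>j. if j = i then 1 else 0" and b = 0])
    (simp add: if_distrib[of "\<lambda>x. x * _"] cong: if_cong)

lemma lin_add:
  assumes "lin V l" "lin V m"
  shows "lin V (\<lambda>p n. l p n + m p n)"
proof -
  from assms obtain a b c d where
    "\<And>p n. l p n = (\<Sum>i\<in>V. a i * p i) + b * int n"
    "\<And>p n. m p n = (\<Sum>i\<in>V. c i * p i) + d * int n"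
    unfolding lin_def by blast
  then show ?thesis
    by (intro linI[where a = "\<lambda>i. a i + c i" and b = "b + d"]) (simp add: algebra_simps sum.distrib)
qed

lemma lin_scale:
  assumes "lin V l"
  shows "lin V (\<lambda>p n. s * l p n)"
proof -
  from assms obtain a b where "\<And>p n. l p n = (\<Sum>i\<in>V. a i * p i) + b * int n"
    unfolding lin_def by blast
  then show ?thesis
    by (intro linI[where a = "\<lambda>i. s * a i" and b = "s * b"])
      (simp add: algebra_simps sum_distrib_left)
qed

lemma lin_diff: "lin V l \<Longrightarrow> lin V m \<Longrightarrow> lin V (\<lambda>p n. l p n - m p n)"
  using lin_add[OF _ lin_scale[of V m "-1"]] by simp

lemma lin_mono:
  assumes "lin U l" "U \<subseteq> V" "finite V"
  shows "lin V l"
proof -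
  from assms obtain a b where l: "\<And>p n. l p n = (\<Sum>i\<in>U. a i * p i) + b * int n"
    unfolding lin_def by blast
  show ?thesis
  proof (rule linI)
    fix p :: "'a \<Rightarrow> int" and n
    have "(\<Sum>i\<in>V. (if i \<in> U then a i else 0) * p i) = (\<Sum>i\<in>U. a i * p i)"
      using assms by (intro sum.mono_neutral_cong_right) auto
    then show "l p n = (\<Sum>i\<in>V. (if i \<in> U then a i else 0) * p i) + b * int n"
      by (simp add: l)
  qed
qed

lemma lin_subst:
  assumes "lin (insert j V) l" "lin V m" "finite V" "j \<notin> V"
  shows "lin V (\<lambda>p n. l (p(j := m p n)) n)"
proof -
  from assms obtain a b where l: "\<And>p n. l p n = (\<Sum>i\<in>insert j V. a i * p i) + b * int n"
    unfolding lin_def by blast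
  have "lin V (\<lambda>p n. a j * m p n + ((\<Sum>i\<in>V. a i * p i) + b * int n))"
    by (intro lin_add lin_scale assms linI[OF refl])
  moreover have "(\<Sum>i\<in>V. a i * (p(j := m p n)) i) = (\<Sum>i\<in>V. a i * p i)" for p n
    using assms(4) by (intro sum.cong) auto
  ultimately show ?thesis
    using assms by (simp add: l add.assoc)
qed

text \<open>Strict positivity is the only generator, since \<open>l \<le> m\<close> is the negation
  of \<open>0 < l - m\<close> and an equation is two weak inequalities. The inductive form lets
  substitution, dependence on the coordinates in \<open>V\<close> alone and eventual constancy be
  proved by induction over three rules.\<close>

inductive tame :: "'i set \<Rightarrow> (('i \<Rightarrow> int) \<Rightarrow> nat \<Rightarrow> bool) \<Rightarrow> bool" for V where
  pos: "lin V l \<Longrightarrow> tame V (\<lambda>p n. 0 < l p n)"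
| neg: "tame V P \<Longrightarrow> tame V (\<lambda>p n. \<not> P p n)"
| conj: "tame V P \<Longrightarrow> tame V Q \<Longrightarrow> tame V (\<lambda>p n. P p n \<and> Q p n)"

lemma tame_subst:
  assumes "tame (insert j V) P" "lin V m" "finite V" "j \<notin> V"
  shows "tame V (\<lambda>p n. P (p(j := m p n)) n)"
  using assms(1)
proof induction
  case (pos l)
  then show ?case by (intro tame.pos lin_subst assms(2-))
qed (auto intro: tame.neg tame.conj)

lemma tame_disj: "tame V P \<Longrightarrow> tame V Q \<Longrightarrow> tame V (\<lambda>p n. P p n \<or> Q p n)"
  using tame.neg[OF tame.conj[OF tame.neg tame.neg, of V P Q]] by simp

lemma tame_le: "lin V l \<Longrightarrow> lin V m \<Longrightarrow> tame V (\<lambda>p n. l p n \<le> m p n)"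
  using tame.neg[OF tame.pos[OF lin_diff[of V l m]]] by (simp add: not_less)

lemma tame_eq: "lin V l \<Longrightarrow> lin V m \<Longrightarrow> tame V (\<lambda>p n. l p n = m p n)"
  using tame.conj[OF tame_le[of V l m] tame_le[of V m l]] by (simp add: eq_iff)

lemma tame_const: "tame V (\<lambda>p n. b)"
proof (cases b)
  case True
  then show ?thesis using tame_eq[OF lin_zero lin_zero] by simp
next
  case False
  then show ?thesis using tame.pos[OF lin_zero] by simp
qed

lemma tame_Ball:
  "finite I \<Longrightarrow> (\<And>i. i \<in> I \<Longrightarrow> tame V (P i)) \<Longrightarrow> tame V (\<lambda>p n. \<forall>i\<in>I. P i p n)"
  by (induction I rule: finite_induct) (auto intro: tame.conj tame_const)

lemma tame_imp_const: "(b \<Longrightarrow> tame V P) \<Longrightarrow> tame V (\<lambda>p n. b \<longrightarrow> P p n)"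
  by (cases b) (auto intro: tame_const)

definition box_count :: "'i set \<Rightarrow> (('i \<Rightarrow> int) \<Rightarrow> nat \<Rightarrow> bool) \<Rightarrow> nat \<Rightarrow> nat" where
  "box_count V P n = card {p \<in> V \<rightarrow>\<^sub>E {1..int n}. P p n}"

lemma finite_box: "finite V \<Longrightarrow> finite {p \<in> V \<rightarrow>\<^sub>E {1..int n}. P p n}"
  by (rule finite_subset[of _ "V \<rightarrow>\<^sub>E {1..int n}"]) (simp_all add: finite_PiE subset_iff)

section \<open>Lattice points and volume\<close>

text \<open>Fubini in the coordinate \<open>j\<close>: since \<open>a j \<noteq> 0\<close>, every
  line parallel to the \<open>j\<close>-axis meets the hyperplane in the single point
  \<open>?c\<close>, and points have Lebesgue measure zero.\<close>

lemma AE_hyperplane: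
  fixes a :: "'i \<Rightarrow> real"
  assumes "finite V" "j \<in> V" "a j \<noteq> 0"
  shows "AE x in PiM V (\<lambda>_. lborel :: real measure). (\<Sum>i\<in>V. a i * x i) + b \<noteq> 0"
proof -
  interpret product_sigma_finite "\<lambda>_. lborel :: real measure" by standard
  define W where "W = V - {j}"
  have V: "V = insert j W" "j \<notin> W" "finite W"
    using assms by (auto simp: W_def)
  let ?M = "\<lambda>V. PiM V (\<lambda>_. lborel :: real measure)"
  let ?H = "{x \<in> space (?M V). (\<Sum>i\<in>V. a i * x i) + b = 0}"
  have m: "?H \<in> sets (?M V)"
    by measurable
  have "emeasure (?M V) ?H = (\<integral>\<^sup>+ x. indicator ?H x \<partial>?M V)"
    using m by simp
  also have "\<dots> = (\<integral>\<^sup>+ x. (\<integral>\<^sup>+ y. indicator ?H (x(j := y)) \<partial>lborel) \<partial>?M W)"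
    using product_nn_integral_insert[OF V(3,2), of "indicator ?H"] m by (simp add: V(1)[symmetric])
  also have "\<dots> = (\<integral>\<^sup>+ x. 0 \<partial>?M W)"
  proof (rule nn_integral_cong)
    fix x assume "x \<in> space (?M W)"
    let ?c = "- ((\<Sum>i\<in>W. a i * x i) + b) / a j"
    have s: "(\<Sum>i\<in>W. a i * (x(j := y)) i) = (\<Sum>i\<in>W. a i * x i)" for y
      using V(2) by (intro sum.cong) auto
    have "indicator ?H (x(j := y)) \<le> (indicator {?c} y :: ennreal)" for y
    proof (cases "x(j := y) \<in> ?H")
      case True
      then have "a j * y + (\<Sum>i\<in>W. a i * x i) + b = 0"
        using V s by simp
      then have "y = ?c"
        using assms(3) by (simp add: field_simps)
      then show ?thesis by (simp add: indicator_def)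
    qed auto
    then have "(\<integral>\<^sup>+ y. indicator ?H (x(j := y)) \<partial>lborel) \<le> (\<integral>\<^sup>+ y. indicator {?c} y \<partial>lborel)"
      by (intro nn_integral_mono)
    also have "\<dots> = 0" by simp
    finally show "(\<integral>\<^sup>+ y. indicator ?H (x(j := y)) \<partial>lborel) = 0" by simp
  qed
  finally have "emeasure (?M V) ?H = 0" by simp
  then show ?thesis
    using m by (intro AE_I[where N = ?H]) auto
qed

text \<open>The lattice point attached to a real point is the upper corner of the cell of side
  \<open>1 / n\<close> containing it; these corners converge to the point.\<close>

lemma ceiling_scaled_tendsto: "(\<lambda>n. of_int \<lceil>real n * x\<rceil> / real n) \<longlonglongrightarrow> x"
proof (rule tendsto_sandwich)
  show "\<forall>\<^sub>F n in sequentially. x \<le> of_int \<lceil>real n * x\<rceil> / real n"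
    using eventually_gt_at_top[of 0] by eventually_elim (simp add: field_simps)
  show "\<forall>\<^sub>F n in sequentially. of_int \<lceil>real n * x\<rceil> / real n \<le> x + 1 / real n"
    using eventually_gt_at_top[of 0]
  proof eventually_elim
    case (elim n)
    then show ?case using of_int_ceiling_le_add_one[of "real n * x"] by (simp add: field_simps)
  qed
  show "(\<lambda>n. x + 1 / real n) \<longlonglongrightarrow> x"
    using tendsto_add[OF tendsto_const lim_1_over_n, of x] by simp
qed auto

text \<open>By homogeneity, a form evaluated at the attached lattice points and divided by
  \<open>n\<close> converges to an affine function of \<open>x\<close>. Off the hyperplane where
  this function vanishes, its sign is eventually the sign of the form. A Boolean combination
  involves finitely many forms, so the exceptional set stays null.\<close>

lemma tame_AE_eventually_const:
  assumes "tame V P" "finite V"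
  shows "AE x in PiM V (\<lambda>_. lborel). \<exists>b. \<forall>\<^sub>F n in sequentially. P (\<lambda>i. \<lceil>real n * x i\<rceil>) n = b"
  using assms(1)
proof induction
  case (pos l)
  then obtain a b where l: "\<And>p n. l p n = (\<Sum>i\<in>V. a i * p i) + b * int n"
    unfolding lin_def by blast
  show ?case
  proof (cases "\<forall>j\<in>V. a j = 0")
    \<comment> \<open>The form is \<open>b * int n\<close>. Its scaled limit \<open>b\<close> may be
      zero on the whole space, so no hyperplane can be discarded, but its sign is the same for all
      positive \<open>n\<close>.\<close>
    case True
    have "\<forall>\<^sub>F n in sequentially. (0 < l (\<lambda>i. \<lceil>real n * x i\<rceil>) n) = (0 < b)" for x
      using eventually_gt_at_top[of 0] by eventually_elim (simp add: l True zero_less_mult_iff)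
    then show ?thesis by blast
  next
    case False
    then obtain j where j: "j \<in> V" "of_int (a j) \<noteq> (0::real)" by auto
    show ?thesis
      using AE_hyperplane[OF assms(2), of j "\<lambda>i. of_int (a i)" "of_int b", OF j]
    proof eventually_elim
      case (elim x)
      let ?s = "(\<Sum>i\<in>V. of_int (a i) * x i) + of_int b"
      have "(\<lambda>n. (\<Sum>i\<in>V. of_int (a i) * (of_int \<lceil>real n * x i\<rceil> / real n)) + of_int b) \<longlonglongrightarrow> ?s"
        by (intro tendsto_intros ceiling_scaled_tendsto)
      moreover have "\<forall>\<^sub>F n in sequentially.
          (\<Sum>i\<in>V. of_int (a i) * (of_int \<lceil>real n * x i\<rceil> / real n)) + of_int b =
          of_int (l (\<lambda>i. \<lceil>real n * x i\<rceil>) n) / real n"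
        using eventually_gt_at_top[of 0]
        by eventually_elim (simp add: l add_divide_distrib sum_divide_distrib)
      ultimately have lim: "(\<lambda>n. of_int (l (\<lambda>i. \<lceil>real n * x i\<rceil>) n) / real n) \<longlonglongrightarrow> ?s"
        by (rule Lim_transform_eventually)
      show ?case
      proof (cases "0 < ?s")
        case True
        have "\<forall>\<^sub>F n in sequentially. (0 < l (\<lambda>i. \<lceil>real n * x i\<rceil>) n) = True"
          using order_tendstoD(1)[OF lim True] eventually_gt_at_top[of 0]
          by eventually_elim (simp add: zero_less_divide_iff)
        then show ?thesis by blast
      next
        case False
        with elim have "?s < 0" by simp
        have "\<forall>\<^sub>F n in sequentially. (0 < l (\<lambda>i. \<lceil>real n * x i\<rceil>) n) = False"
          using order_tendstoD(2)[OF lim \<open>?s < 0\<close>] eventually_gt_at_top[of 0]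
          by eventually_elim (simp add: divide_less_0_iff)
        then show ?thesis by blast
      qed
    qed
  qed
next
  case (neg P)
  from neg.IH show ?case
    by eventually_elim (auto elim!: eventually_mono)
next
  case (conj P Q)
  from conj.IH show ?case
  proof eventually_elim
    case (elim x)
    then obtain b b' where
      "\<forall>\<^sub>F n in sequentially. P (\<lambda>i. \<lceil>real n * x i\<rceil>) n = b"
      "\<forall>\<^sub>F n in sequentially. Q (\<lambda>i. \<lceil>real n * x i\<rceil>) n = b'" by blast
    then have "\<forall>\<^sub>F n in sequentially.
        (P (\<lambda>i. \<lceil>real n * x i\<rceil>) n \<and> Q (\<lambda>i. \<lceil>real n * x i\<rceil>) n) = (b \<and> b')"
      by eventually_elim simp
    then show ?case by blast
  qed
qed

lemma tame_cong: "tame V P \<Longrightarrow> (\<And>i. i \<in> V \<Longrightarrow> p i = q i) \<Longrightarrow> P p n = P q n"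
proof (induction rule: tame.induct)
  case (pos l)
  then show ?case using lin_cong[of V l p q n] by simp
qed auto

text \<open>The quotient is exactly the volume of \<open>A n\<close>, which is tiled by one cell of
  volume \<open>1 / n ^ card V\<close> for each lattice point counted. The indicators of these sets
  converge almost everywhere and are dominated by the indicator of the unit cube, so dominated
  convergence applies. The limit function is written as a pointwise \<open>lim\<close>, which avoids
  describing the limiting region.\<close>

lemma tame_density:
  assumes "tame V P" "finite V"
  shows "convergent (\<lambda>n. real (box_count V P n) / real n ^ card V)"
proof -
  interpret product_sigma_finite "\<lambda>_. lborel :: real measure" by standard
  let ?M = "PiM V (\<lambda>_. lborel :: real measure)"
  \<comment> \<open>Excluding 0 and including 1 makes the ceilings of \<open>real n * x i\<close>
    run through exactly \<open>1..n\<close>.\<close>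
  define U where "U = V \<rightarrow>\<^sub>E {0<..1::real}"
  define A where "A n = {x \<in> U. P (\<lambda>i. \<lceil>real n * x i\<rceil>) n}" for n
  define C where "C n = {p \<in> V \<rightarrow>\<^sub>E {1..int n}. P p n}" for n
  \<comment> \<open>The cell of points whose scaled coordinates in \<open>V\<close> have ceilings
    given by \<open>p\<close>. Being open on the left and closed on the right, cells for distinct
    lattice points are disjoint.\<close>
  define B where "B n p = (\<Pi>\<^sub>E i\<in>V. {(real_of_int (p i) - 1) / real n <.. real_of_int (p i) / real n})"
    for n and p :: "'a \<Rightarrow> int"
  have B: "B n p \<in> sets ?M" for n p
    unfolding B_def using assms(2) by (intro sets_PiM_I_finite) auto
  have finC: "finite (C n)" for n
    unfolding C_def by (rule finite_box[OF assms(2)])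
  have ceil: "x \<in> {(real_of_int k - 1) / real n <.. real_of_int k / real n} \<longleftrightarrow> \<lceil>real n * x\<rceil> = k"
    if "n > 0" for x k n
    using that by (auto simp: ceiling_eq_iff field_simps)
  have unit: "x \<in> {0<..1} \<longleftrightarrow> \<lceil>real n * x\<rceil> \<in> {1..int n}" if "n > 0" for x n
  proof -
    have "0 < x \<longleftrightarrow> 0 < real n * x" "x \<le> 1 \<longleftrightarrow> real n * x \<le> real n"
      using that by (simp_all add: zero_less_mult_iff)
    moreover have "0 < real n * x \<longleftrightarrow> 1 \<le> \<lceil>real n * x\<rceil>" by linarith
    moreover have "real n * x \<le> real n \<longleftrightarrow> \<lceil>real n * x\<rceil> \<le> int n" by linarith
    ultimately show ?thesis unfolding greaterThanAtMost_iff atLeastAtMost_iff by metis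
  qed
  have AB: "A n = (\<Union>p\<in>C n. B n p)" if "n > 0" for n
  proof (rule equalityI; rule subsetI)
    fix x assume x: "x \<in> A n"
    \<comment> \<open>The members of \<open>C n\<close> are extensional, hence the restriction;
      \<open>P\<close> only sees coordinates in \<open>V\<close>, so its truth value is
      kept.\<close>
    let ?p = "restrict (\<lambda>i. \<lceil>real n * x i\<rceil>) V"
    have "P ?p n"
      using x tame_cong[OF assms(1), of ?p "\<lambda>i. \<lceil>real n * x i\<rceil>" n] by (simp add: A_def)
    moreover have "?p \<in> V \<rightarrow>\<^sub>E {1..int n}"
    proof (rule restrict_PiE_iff[THEN iffD2], rule ballI)
      fix i assume "i \<in> V"
      then have "x i \<in> {0<..1}" using x by (auto simp: A_def U_def)
      then show "\<lceil>real n * x i\<rceil> \<in> {1..int n}" using unit[OF that] by blast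
    qed
    ultimately have "?p \<in> C n" by (simp add: C_def)
    moreover have "x \<in> B n ?p"
      using x ceil[OF that] unfolding B_def A_def U_def PiE_iff by (simp add: extensional_def)
    ultimately show "x \<in> (\<Union>p\<in>C n. B n p)" by blast
  next
    fix x assume "x \<in> (\<Union>p\<in>C n. B n p)"
    then obtain p where p: "p \<in> C n" "x \<in> B n p" by blast
    then have eq: "\<lceil>real n * x i\<rceil> = p i" if "i \<in> V" for i
      using ceil[OF \<open>n > 0\<close>] that unfolding B_def PiE_iff by blast
    have "P (\<lambda>i. \<lceil>real n * x i\<rceil>) n"
      using p(1) tame_cong[OF assms(1), of "\<lambda>i. \<lceil>real n * x i\<rceil>" p n] eq by (simp add: C_def)
    moreover have "x \<in> U"
      unfolding U_def PiE_iff
    proof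
      show "\<forall>i\<in>V. x i \<in> {0<..1}"
      proof
        fix i assume i: "i \<in> V"
        then have "p i \<in> {1..int n}" using p(1) by (auto simp: C_def)
        then show "x i \<in> {0<..1}" using unit[OF \<open>n > 0\<close>, of "x i"] eq[OF i] by (simp only:)
      qed
      show "x \<in> extensional V" using p(2) by (simp add: B_def PiE_iff)
    qed
    ultimately show "x \<in> A n" by (simp add: A_def)
  qed
  have mB: "emeasure ?M (B n p) = ennreal (1 / real n ^ card V)" if "n > 0" for n p
  proof -
    have "emeasure ?M (B n p) =
        (\<Prod>i\<in>V. emeasure lborel {(real_of_int (p i) - 1) / real n <.. real_of_int (p i) / real n})"
      unfolding B_def using assms(2) by (intro emeasure_PiM) auto
    also have "\<dots> = (\<Prod>i\<in>V. ennreal (1 / real n))"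
      by (intro prod.cong refl, subst emeasure_lborel_Ioc)
        (simp_all add: divide_right_mono diff_divide_distrib[symmetric])
    also have "\<dots> = ennreal ((1 / real n) ^ card V)"
      by (simp add: ennreal_power)
    finally show ?thesis by (simp add: power_one_over)
  qed
  have disj: "disjoint_family_on (B n) (C n)" if "n > 0" for n
  proof (unfold disjoint_family_on_def, intro ballI impI, rule ccontr)
    fix p q assume pq: "p \<in> C n" "q \<in> C n" "p \<noteq> q" "B n p \<inter> B n q \<noteq> {}"
    then obtain x where x: "x \<in> B n p" "x \<in> B n q" by blast
    have "p i = q i" if "i \<in> V" for i
      using x that ceil[OF \<open>n > 0\<close>] unfolding B_def PiE_iff by metis
    then have "p = q"
      using pq(1,2) unfolding C_def by (intro PiE_ext[where k = V]) auto
    with pq show False by simp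
  qed
  have mA: "measure ?M (A n) = real (box_count V P n) / real n ^ card V" if "n > 0" for n
  proof -
    have "measure ?M (A n) = (\<Sum>p\<in>C n. measure ?M (B n p))"
      unfolding AB[OF that] using finC B disj[OF that] mB[OF that]
      by (intro measure_finite_Union) (auto simp: image_subset_iff)
    also have "\<dots> = (\<Sum>p\<in>C n. 1 / real n ^ card V)"
      using mB[OF that] by (intro sum.cong) (simp_all add: measure_def)
    finally show ?thesis by (simp add: box_count_def C_def)
  qed
  have setsA: "A n \<in> sets ?M" if "n > 0" for n
    unfolding AB[OF that] using finC B by (intro sets.finite_UN) auto
  have U: "U \<in> sets ?M"
    unfolding U_def using assms(2) by (intro sets_PiM_I_finite) auto
  have eU: "emeasure ?M U < \<infinity>"
    unfolding U_def using assms(2) by (subst emeasure_PiM) auto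
  \<comment> \<open>The shift to \<open>Suc n\<close> gives every term a positive mesh, as the facts
    about \<open>A\<close> require.\<close>
  define f where "f n x = (indicator (A (Suc n)) x :: real)" for n x
  have f: "f n \<in> borel_measurable ?M" for n
    unfolding f_def using setsA by simp
  have "(\<lambda>n. integral\<^sup>L ?M (f n)) \<longlonglongrightarrow> integral\<^sup>L ?M (\<lambda>x. lim (\<lambda>n. f n x))"
  proof (rule integral_dominated_convergence[where w = "indicator U"])
    show "(\<lambda>x. lim (\<lambda>n. f n x)) \<in> borel_measurable ?M"
      using f by (rule borel_measurable_lim_metric)
    show "integrable ?M (indicator U :: _ \<Rightarrow> real)"
      using U eU by simp
    show "AE x in ?M. (\<lambda>n. f n x) \<longlonglongrightarrow> lim (\<lambda>n. f n x)"
      using tame_AE_eventually_const[OF assms]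
    proof eventually_elim
      case (elim x)
      then obtain b where b: "\<forall>\<^sub>F n in sequentially. P (\<lambda>i. \<lceil>real n * x i\<rceil>) n = b" by blast
      have "\<forall>\<^sub>F n in sequentially. f n x = (if x \<in> U \<and> b then 1 else 0)"
        using eventually_compose_filterlim[OF b filterlim_Suc]
        by eventually_elim (auto simp: f_def A_def)
      then have "(\<lambda>n. f n x) \<longlonglongrightarrow> (if x \<in> U \<and> b then 1 else 0)"
        by (rule tendsto_eventually)
      then show ?case by (simp add: convergentI convergent_LIMSEQ_iff[symmetric])
    qed
    show "AE x in ?M. norm (f n x) \<le> indicator U x" for n
      by (auto simp: f_def A_def indicator_def)
  qed (fact f)
  moreover have "integral\<^sup>L ?M (f n) = real (box_count V P (Suc n)) / real (Suc n) ^ card V" for n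
  proof -
    have "f n = indicator (A (Suc n))" by (simp add: f_def fun_eq_iff)
    then show ?thesis using setsA[of "Suc n"] mA[of "Suc n"] by simp
  qed
  ultimately have "convergent (\<lambda>n. real (box_count V P (Suc n)) / real (Suc n) ^ card V)"
    by (auto simp: convergent_def)
  then show ?thesis
    by (subst (asm) convergent_Suc_iff)
qed

section \<open>Eliminating determined coordinates\<close>

lemma box_count_split:
  assumes "finite V"
  shows "box_count V P n =
    box_count V (\<lambda>p n. P p n \<and> Q p n) n + box_count V (\<lambda>p n. P p n \<and> \<not> Q p n) n"
proof -
  have "{p \<in> V \<rightarrow>\<^sub>E {1..int n}. P p n} =
      {p \<in> V \<rightarrow>\<^sub>E {1..int n}. P p n \<and> Q p n} \<union> {p \<in> V \<rightarrow>\<^sub>E {1..int n}. P p n \<and> \<not> Q p n}"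
    by blast
  then show ?thesis
    unfolding box_count_def by (simp only:) (rule card_Un_disjoint; use assms in \<open>auto intro: finite_box\<close>)
qed

text \<open>Forgetting the coordinate \<open>j\<close> and restoring it as \<open>m p n\<close> are
  mutually inverse, because \<open>m\<close> does not read coordinate \<open>j\<close>. The box
  constraint on that coordinate survives as the two bounds on \<open>m p n\<close>.\<close>

lemma box_count_subst:
  assumes "j \<notin> V" "lin V m"
    and det: "\<And>p. p \<in> insert j V \<rightarrow>\<^sub>E {1..int n} \<Longrightarrow> P p n \<Longrightarrow> p j = m p n"
  shows "box_count (insert j V) P n =
    box_count V (\<lambda>p n. P (p(j := m p n)) n \<and> 0 < m p n \<and> m p n \<le> int n) n"
  unfolding box_count_def
proof (rule bij_betw_same_card[OF bij_betw_byWitness[where f = "\<lambda>p. p(j := undefined)"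
        and f' = "\<lambda>p. p(j := m p n)"]])
  let ?f = "\<lambda>p. p(j := undefined)" and ?g = "\<lambda>p. p(j := m p n)"
  let ?S = "{p \<in> insert j V \<rightarrow>\<^sub>E {1..int n}. P p n}"
  let ?T = "{p \<in> V \<rightarrow>\<^sub>E {1..int n}. P (p(j := m p n)) n \<and> 0 < m p n \<and> m p n \<le> int n}"
  have m: "m (p(j := y)) n = m p n" for p y
    using assms(1) by (intro lin_cong[OF assms(2)]) auto
  have gf: "?g (?f p) = p" if "p \<in> ?S" for p
  proof -
    have "m p n = p j" using det[of p] that by simp
    then show ?thesis by (simp add: m)
  qed
  have fg: "?f (?g p) = p" if "p \<in> ?T" for p
    using that assms(1) by (auto simp: PiE_iff extensional_def)
  show "\<forall>p\<in>?S. ?g (?f p) = p" using gf by blast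
  show "\<forall>p\<in>?T. ?f (?g p) = p" using fg by blast
  show "?f ` ?S \<subseteq> ?T"
  proof (rule image_subsetI)
    fix p assume p: "p \<in> ?S"
    then have "p j = m p n" "p j \<in> {1..int n}" using det by auto
    moreover have "?f p \<in> V \<rightarrow>\<^sub>E {1..int n}"
      using p assms(1) by (auto simp: PiE_iff extensional_def)
    moreover have "P ((?f p)(j := m (?f p) n)) n" using gf[OF p] p by simp
    ultimately show "?f p \<in> ?T" by (simp add: m)
  qed
  show "?g ` ?T \<subseteq> ?S"
  proof (rule image_subsetI)
    fix p assume p: "p \<in> ?T"
    then show "?g p \<in> ?S"
      by (auto simp: PiE_iff extensional_def)
  qed
qed

text \<open>Each coordinate in \<open>D\<close> takes one of finitely many values computed from
  smaller coordinates, so only those in \<open>V - D\<close> contribute to the growth. The outer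
  induction removes the largest element of \<open>D\<close> first: the candidate forms of the
  smaller elements do not read it and survive the substitution unchanged. An inner induction runs
  through the candidate forms of the element being removed.\<close>

lemma tame_density_determined:
  fixes V D :: "'i :: linorder set"
  assumes "finite D" "\<And>j. j \<in> D \<Longrightarrow> finite (F j)"
    and "D \<subseteq> V" "finite V" "tame V P"
    and "\<And>j m. j \<in> D \<Longrightarrow> m \<in> F j \<Longrightarrow> lin (V \<inter> {..<j}) m"
    and "\<And>n p j. p \<in> V \<rightarrow>\<^sub>E {1..int n} \<Longrightarrow> P p n \<Longrightarrow> j \<in> D \<Longrightarrow> \<exists>m\<in>F j. p j = m p n"
  shows "convergent (\<lambda>n. real (box_count V P n) / real n ^ card (V - D))"
  using assms
proof (induction D arbitrary: V P rule: finite_linorder_max_induct)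
  case empty
  then show ?case using tame_density by auto
next
  case (insert j D)
  note outer = insert.hyps insert.prems and outer_IH = insert.IH
  define W where "W = V - {j}"
  have V: "V = insert j W" "j \<notin> W" "finite W" "V - insert j D = W - D"
    using insert.prems by (auto simp: W_def)
  have less: "V \<inter> {..<i} = W \<inter> {..<i}" if "i \<in> insert j D" for i
    using insert.hyps(2) that by (auto simp: W_def)
  have jD: "j \<notin> D" using insert.hyps(2) by auto
  \<comment> \<open>\<open>G\<close> holds the candidates still to be tried for coordinate
    \<open>j\<close>. \<open>Q\<close> is \<open>P\<close> together with the failure of those
    already tried, kept abstract as a condition that implies \<open>P\<close> on the box.\<close>
  have inner: "convergent (\<lambda>n. real (box_count V Q n) / real n ^ card (W - D))"
    if "finite G" "\<And>m. m \<in> G \<Longrightarrow> lin (W \<inter> {..<j}) m" "tame V Q"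
      "\<And>n p. p \<in> V \<rightarrow>\<^sub>E {1..int n} \<Longrightarrow> Q p n \<Longrightarrow> P p n"
      "\<And>n p. p \<in> V \<rightarrow>\<^sub>E {1..int n} \<Longrightarrow> Q p n \<Longrightarrow> \<exists>m\<in>G. p j = m p n"
    for G Q
    using that
  proof (induction G arbitrary: Q rule: finite_induct)
    case empty
    then have "{p \<in> V \<rightarrow>\<^sub>E {1..int n}. Q p n} = {}" for n by blast
    then have "box_count V Q n = 0" for n unfolding box_count_def by (metis card.empty)
    then show ?case by (simp add: convergent_const)
  next
    case (insert m G)
    \<comment> \<open>Splitting on whether \<open>m\<close> gives the value keeps the two counts
      disjoint, so a point where several candidates agree is counted once. \<open>?Q1\<close> loses
      the coordinate \<open>j\<close>; \<open>?Q2\<close> loses the candidate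
      \<open>m\<close>.\<close>
    let ?Q1 = "\<lambda>p n. Q p n \<and> p j = m p n"
    let ?Q2 = "\<lambda>p n. Q p n \<and> \<not> p j = m p n"
    let ?R = "\<lambda>p n. ?Q1 (p(j := m p n)) n \<and> 0 < m p n \<and> m p n \<le> int n"
    have m: "lin W m"
      by (rule lin_mono[OF insert.prems(1)]) (use V in auto)
    have mV: "lin V m" by (rule lin_mono[OF m]) (use V in auto)
    have "tame V (\<lambda>p n. p j = m p n)"
      using V by (intro tame_eq lin_var mV) auto
    then have t: "tame V ?Q1" "tame V ?Q2"
      using insert.prems(2) by (auto intro: tame.conj tame.neg)
    have bounded: "p(j := m p n) \<in> V \<rightarrow>\<^sub>E {1..int n}"
      if "p \<in> W \<rightarrow>\<^sub>E {1..int n}" "?R p n" for p n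
      using that V by (auto simp: PiE_iff extensional_def)
    have "convergent (\<lambda>n. real (box_count W ?R n) / real n ^ card (W - D))"
    proof (rule outer_IH)
      show "finite (F i)" if "i \<in> D" for i using outer(3) that by blast
      show "D \<subseteq> W" using outer(4) jD by (auto simp: W_def)
      show "finite W" by (fact V)
      have "tame W (\<lambda>p n. ?Q1 (p(j := m p n)) n)"
        using t(1) unfolding V(1) by (rule tame_subst[OF _ m V(3,2)])
      then show "tame W ?R"
        by (rule tame.conj[OF _ tame.conj[OF tame.pos[OF m] tame_le[OF m lin_size]]])
      show "lin (W \<inter> {..<i}) l" if "i \<in> D" "l \<in> F i" for i l
        using outer(7)[of i l] less[of i] that by simp
      show "\<exists>l\<in>F i. p i = l p n" if p: "p \<in> W \<rightarrow>\<^sub>E {1..int n}" "?R p n" and i: "i \<in> D" for p n i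
      proof -
        let ?p = "p(j := m p n)"
        have "Q ?p n" using p(2) by blast
        then have "P ?p n" by (rule insert.prems(3)[OF bounded[OF p]])
        then obtain l where l: "l \<in> F i" "?p i = l ?p n"
          using outer(8)[OF bounded[OF p], of i] i by blast
        have "i < j" using outer(2) i by blast
        \<comment> \<open>\<open>l\<close> reads only coordinates below \<open>i\<close>, hence not
          the coordinate \<open>j\<close> that was filled in.\<close>
        have "l ?p n = l p n"
          by (rule lin_cong[OF outer(7)[OF insertI2[OF i] l(1)]]) (use \<open>i < j\<close> in auto)
        then have "p i = l p n" using l(2) less_imp_neq[OF \<open>i < j\<close>] by simp
        then show ?thesis using l(1) by blast
      qed
    qed
    moreover have "box_count V ?Q1 n = box_count W ?R n" for n
      unfolding V(1) by (rule box_count_subst[OF V(2) m]) simp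
    moreover have "convergent (\<lambda>n. real (box_count V ?Q2 n) / real n ^ card (W - D))"
    proof (rule insert.IH)
      show "lin (W \<inter> {..<j}) l" if "l \<in> G" for l using insert.prems(1) that by blast
      show "tame V ?Q2" by (fact t)
      show "P p n" if "p \<in> V \<rightarrow>\<^sub>E {1..int n}" "?Q2 p n" for n p
        using insert.prems(3)[OF that(1)] that(2) by blast
      show "\<exists>l\<in>G. p j = l p n" if "p \<in> V \<rightarrow>\<^sub>E {1..int n}" "?Q2 p n" for n p
        using insert.prems(4)[OF that(1)] that(2) by blast
    qed
    ultimately have "convergent (\<lambda>n. real (box_count V ?Q1 n) / real n ^ card (W - D)
        + real (box_count V ?Q2 n) / real n ^ card (W - D))"
      by (intro convergent_add) simp_all
    then show ?case
      using box_count_split[of V Q _ "\<lambda>p n. p j = m p n"] insert.prems V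
      by (simp add: add_divide_distrib)
  qed
  show ?case
    unfolding V(4)
  proof (rule inner)
    show "finite (F j)" by (rule outer(3)[OF insertI1])
    show "lin (W \<inter> {..<j}) m" if "m \<in> F j" for m
      using outer(7)[OF insertI1 that] unfolding less[OF insertI1] .
    show "tame V P" by (rule outer(6))
    show "\<exists>m\<in>F j. p j = m p n" if "p \<in> V \<rightarrow>\<^sub>E {1..int n}" "P p n" for n p
      by (rule outer(8)[OF that insertI1])
  qed
qed

section \<open>The five link functions\<close>

text \<open>\<open>E\<close> extends the equation \<open>L n a b = L n c d\<close> from the box to
  all integers, and \<open>F\<close> lists the possible solutions for \<open>d\<close>. The indices
  are not assumed distinct, because two matched steps of a circuit may share a vertex.\<close>

definition linear_link ::
  "link \<Rightarrow> (nat \<Rightarrow> int \<Rightarrow> int \<Rightarrow> int \<Rightarrow> int \<Rightarrow> bool) \<Rightarrow> (nat \<Rightarrow> int \<Rightarrow> int \<Rightarrow> int \<Rightarrow> int) set \<Rightarrow> bool" where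
  "linear_link L E F \<longleftrightarrow>
     (\<forall>n. \<forall>a\<in>{1..n}. \<forall>b\<in>{1..n}. \<forall>c\<in>{1..n}. \<forall>d\<in>{1..n}.
        E n (int a) (int b) (int c) (int d) \<longleftrightarrow> L n a b = L n c d) \<and>
     (\<forall>(V :: nat set) i i' j j'. finite V \<longrightarrow> i \<in> V \<longrightarrow> i' \<in> V \<longrightarrow> j \<in> V \<longrightarrow> j' \<in> V \<longrightarrow>
        tame V (\<lambda>p n. E n (p i) (p i') (p j) (p j'))) \<and>
     finite F \<and>
     (\<forall>f\<in>F. \<forall>(V :: nat set) i i' j. finite V \<longrightarrow> i \<in> V \<longrightarrow> i' \<in> V \<longrightarrow> j \<in> V \<longrightarrow>
        lin V (\<lambda>p n. f n (p i) (p i') (p j))) \<and>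
     (\<forall>n a b c d. E n a b c d \<longrightarrow> (\<exists>f\<in>F. d = f n a b c))"

lemma linear_link_eq:
  assumes "linear_link L E F" "a \<in> {1..n}" "b \<in> {1..n}" "c \<in> {1..n}" "d \<in> {1..n}"
  shows "E n (int a) (int b) (int c) (int d) \<longleftrightarrow> L n a b = L n c d"
  by (rule assms(1)[unfolded linear_link_def, THEN conjunct1, rule_format, OF assms(2-)])

lemma linear_link_tame:
  fixes V :: "nat set"
  assumes "linear_link L E F" "finite V" "i \<in> V" "i' \<in> V" "j \<in> V" "j' \<in> V"
  shows "tame V (\<lambda>p n. E n (p i) (p i') (p j) (p j'))"
  by (rule assms(1)[unfolded linear_link_def, THEN conjunct2, THEN conjunct1, rule_format,
        OF assms(2-)])

lemma linear_link_lin: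
  fixes V :: "nat set"
  assumes "linear_link L E F" "f \<in> F" "finite V" "i \<in> V" "i' \<in> V" "j \<in> V"
  shows "lin V (\<lambda>p n. f n (p i) (p i') (p j))"
  by (rule assms(1)[unfolded linear_link_def, THEN conjunct2, THEN conjunct2, THEN conjunct2,
        THEN conjunct1, rule_format, OF assms(2-)])

lemma linear_link_solution:
  assumes "linear_link L E F" "E n a b c d"
  obtains f where "f \<in> F" "d = f n a b c"
  using assms(1)[unfolded linear_link_def, THEN conjunct2, THEN conjunct2, THEN conjunct2,
      THEN conjunct2, rule_format, OF assms(2)] by (rule bexE)

lemma finite_linear_link: "linear_link L E F \<Longrightarrow> finite F"
  by (simp add: linear_link_def)

lemma linear_linkI:
  assumes "\<And>n a b c d. a \<in> {1..n} \<Longrightarrow> b \<in> {1..n} \<Longrightarrow> c \<in> {1..n} \<Longrightarrow> d \<in> {1..n} \<Longrightarrow>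
      E n (int a) (int b) (int c) (int d) \<longleftrightarrow> L n a b = L n c d"
    and "\<And>(V :: nat set) i i' j j'. finite V \<Longrightarrow> i \<in> V \<Longrightarrow> i' \<in> V \<Longrightarrow> j \<in> V \<Longrightarrow> j' \<in> V \<Longrightarrow>
      tame V (\<lambda>p n. E n (p i) (p i') (p j) (p j'))"
    and "finite F"
    and "\<And>f (V :: nat set) i i' j. f \<in> F \<Longrightarrow> finite V \<Longrightarrow> i \<in> V \<Longrightarrow> i' \<in> V \<Longrightarrow> j \<in> V \<Longrightarrow>
      lin V (\<lambda>p n. f n (p i) (p i') (p j))"
    and "\<And>n a b c d. E n a b c d \<Longrightarrow> \<exists>f\<in>F. d = f n a b c"
  shows "linear_link L E F"
  unfolding linear_link_def by (intro conjI allI ballI impI assms)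

lemmas lin_intros = lin_size lin_var lin_add lin_diff
lemmas tame_intros = tame_disj tame.conj tame_eq

text \<open>Equal minimum and maximum mean equal unordered pairs. Each alternative consists of two
  equations: one solves for \<open>d\<close>, the other remains a constraint inside
  \<open>E\<close>.\<close>

lemma linear_link_wigner:
  "linear_link wigner_link (\<lambda>n a b c d. a = c \<and> b = d \<or> a = d \<and> b = c)
     {\<lambda>n a b c. a, \<lambda>n a b c. b}"
proof (rule linear_linkI, goal_cases)
  case 1
  then show ?case by (auto simp: wigner_link_def min_def max_def)
next
  case 2
  then show ?case by (intro tame_intros lin_intros)
next
  case (4 f)
  from 4(1) show ?case
    by (elim insertE emptyE) (simp_all only:, (intro lin_intros 4)+)
qed auto

text \<open>The two alternatives are \<open>a - b = c - d\<close> and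
  \<open>a - b = d - c\<close>.\<close>

lemma linear_link_toeplitz:
  "linear_link toeplitz_link (\<lambda>n a b c d. a + d = b + c \<or> a + c = b + d)
     {\<lambda>n a b c. b + c - a, \<lambda>n a b c. a + c - b}"
proof (rule linear_linkI, goal_cases)
  case 1
  then show ?case by (simp add: toeplitz_link_def) linarith
next
  case 2
  then show ?case by (intro tame_intros lin_intros)
next
  case (4 f)
  from 4(1) show ?case
    by (elim insertE emptyE) (simp_all only:, (intro lin_intros 4)+)
qed auto

lemma linear_link_hankel:
  "linear_link hankel_link (\<lambda>n a b c d. a + b = c + d) {\<lambda>n a b c. a + b - c}"
proof (rule linear_linkI, goal_cases)
  case 1
  then show ?case by (simp add: hankel_link_def)
next
  case 2
  then show ?case by (intro tame_intros lin_intros)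
next
  case (4 f)
  from 4(1) show ?case
    by (elim insertE emptyE) (simp_all only:, (intro lin_intros 4)+)
qed auto

text \<open>The difference is a multiple of \<open>n\<close>, and only the factors -1, 0 and 1 keep
  it below \<open>2 * n\<close> in absolute value. Two sums of two numbers from \<open>1..n\<close>
  are always this close.\<close>

lemma mod_eq_iff_of_less_double:
  fixes x y n :: int
  assumes "\<bar>x - y\<bar> < 2 * n"
  shows "x mod n = y mod n \<longleftrightarrow> x = y \<or> x = y + n \<or> y = x + n"
proof
  assume "x mod n = y mod n"
  then obtain k where k: "x - y = n * k" by (auto simp: mod_eq_dvd_iff dvd_def)
  have n: "n > 0" using assms by linarith
  have "\<bar>k\<bar> < 2"
  proof (rule ccontr)
    assume "\<not> \<bar>k\<bar> < 2"
    then have "n * 2 \<le> n * \<bar>k\<bar>" using n by (intro mult_left_mono) auto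
    then show False using assms n by (simp add: k abs_mult)
  qed
  then have "k = -1 \<or> k = 0 \<or> k = 1" by linarith
  then show "x = y \<or> x = y + n \<or> y = x + n" using k by auto
qed auto

lemma linear_link_reverse_circulant:
  "linear_link reverse_circulant_link
     (\<lambda>n a b c d. a + b = c + d \<or> a + b = c + d + int n \<or> c + d = a + b + int n)
     {\<lambda>n a b c. a + b - c, \<lambda>n a b c. a + b - c - int n, \<lambda>n a b c. a + b + int n - c}"
proof -
  have "(int a + int b = int c + int d \<or> int a + int b = int c + int d + int n \<or>
      int c + int d = int a + int b + int n) \<longleftrightarrow> int ((a + b) mod n) = int ((c + d) mod n)"
    if "a \<in> {1..n}" "b \<in> {1..n}" "c \<in> {1..n}" "d \<in> {1..n}" for n a b c d
    using mod_eq_iff_of_less_double[of "int a + int b" "int c + int d" "int n"] that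
    by (simp add: zmod_int abs_if)
  note eq = this
  show ?thesis
  proof (rule linear_linkI, goal_cases)
    case 1
    then show ?case unfolding reverse_circulant_link_def list.inject by (simp only: eq simp_thms)
  next
    case 2
    then show ?case by (intro tame_intros lin_intros)
  next
    case (4 f)
    from 4(1) show ?case
      by (elim insertE emptyE) (simp_all only:, (intro lin_intros 4)+)
  qed auto
qed

lemma symmetric_circulant_link_eq:
  "symmetric_circulant_link n i j =
     [min \<bar>int i - int j\<bar> (int n - \<bar>int i - int j\<bar>)]"
proof -
  have "real n / 2 - \<bar>real n / 2 - \<bar>real i - real j\<bar>\<bar> =
      of_int (min \<bar>int i - int j\<bar> (int n - \<bar>int i - int j\<bar>))"
    by (auto simp: min_def abs_if)
  then show ?thesis by (simp only: symmetric_circulant_link_def floor_of_int)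
qed

text \<open>With \<open>s\<close> and \<open>t\<close> the absolute differences, the links agree iff
  \<open>s = t\<close> or \<open>s + t = n\<close>. Resolving the signs gives two equations from the
  first case and four from the second. Conversely, since \<open>s\<close> and \<open>t\<close> are
  less than \<open>n\<close>, signed differences can combine to \<open>n\<close> or
  \<open>-n\<close> only when their absolute values add up.\<close>

lemma linear_link_symmetric_circulant:
  "linear_link symmetric_circulant_link
     (\<lambda>n a b c d. a + d = b + c \<or> a + d = b + c + int n \<or> b + c = a + d + int n \<or>
        a + c = b + d \<or> a + c = b + d + int n \<or> b + d = a + c + int n)
     {\<lambda>n a b c. b + c - a, \<lambda>n a b c. b + c + int n - a, \<lambda>n a b c. b + c - a - int n,
      \<lambda>n a b c. a + c - b, \<lambda>n a b c. a + c - b - int n, \<lambda>n a b c. a + c + int n - b}"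
proof -
  have eq: "(a + d = b + c \<or> a + d = b + c + n \<or> b + c = a + d + n \<or>
        a + c = b + d \<or> a + c = b + d + n \<or> b + d = a + c + n) \<longleftrightarrow>
      min (abs (a - b)) (n - abs (a - b)) = min (abs (c - d)) (n - abs (c - d))" (is "?l \<longleftrightarrow> ?r")
    if "1 \<le> a" "a \<le> n" "1 \<le> b" "b \<le> n" "1 \<le> c" "c \<le> n" "1 \<le> d" "d \<le> n" for n a b c d :: int
  proof -
    have min: "min s (n - s) = min t (n - t) \<longleftrightarrow> s = t \<or> s + t = n" for s t :: int
      by (simp add: min_def) linarith
    have "?r \<longleftrightarrow> abs (a - b) = abs (c - d) \<or> abs (a - b) + abs (c - d) = n"
      by (rule min)
    also have "\<dots> \<longleftrightarrow> ?l"
      using that by (cases "a \<le> b"; cases "c \<le> d") (simp_all add: abs_if, linarith+)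
    finally show ?thesis by blast
  qed
  show ?thesis
  proof (rule linear_linkI, goal_cases)
    case (1 n a b c d)
    then show ?case
      using eq[of "int a" "int n" "int b" "int c" "int d"]
      unfolding symmetric_circulant_link_eq list.inject by (simp only: simp_thms) simp
  next
    case 2
    then show ?case by (intro tame_intros lin_intros)
  next
    case (4 f)
    from 4(1) show ?case
      by (elim insertE emptyE) (simp_all only:, (intro lin_intros 4)+)
  qed auto
qed

lemma five_links_linear:
  assumes "L \<in> five_links"
  shows "\<exists>E F. linear_link L E F"
  using assms linear_link_wigner linear_link_toeplitz linear_link_hankel
    linear_link_symmetric_circulant linear_link_reverse_circulant
  unfolding five_links_def by blast

section \<open>Circuits\<close>

text \<open>Circuits have natural values while linear forms need integers; \<open>int\<close> and
  \<open>nat\<close> are inverse to each other on the boxes. Equal letters have equal colors by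
  \<open>CW2\<close>, so the relation \<open>E\<close> for the color at \<open>i\<close> expresses
  the link equation for both positions.\<close>

lemma card_Pi_C_star:
  assumes c: "set c \<subseteq> {1, 2}" and w: "w \<in> CW2 c"
    and E: "\<And>i. i \<in> {1, 2} \<Longrightarrow> linear_link (L i) (E i) (F i)"
  shows "card (Pi_C_star L c w n) = box_count {0..length c} (\<lambda>p n. p 0 = p (length c) \<and>
    (\<forall>i\<in>{1..length c}. \<forall>j\<in>{1..length c}. w ! (i - 1) = w ! (j - 1) \<longrightarrow>
      E (c ! (i - 1)) n (p (i - 1)) (p i) (p (j - 1)) (p j))) n"
  unfolding box_count_def
proof (rule bij_betw_same_card[OF bij_betw_byWitness[
        where f = "\<lambda>\<pi>. restrict (\<lambda>i. int (\<pi> i)) {0..length c}"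
        and f' = "\<lambda>p. restrict (\<lambda>i. nat (p i)) {0..length c}"]])
  let ?k = "length c"
  let ?Q = "\<lambda>p. p 0 = p ?k \<and>
    (\<forall>i\<in>{1..?k}. \<forall>j\<in>{1..?k}. w ! (i - 1) = w ! (j - 1) \<longrightarrow>
      E (c ! (i - 1)) n (p (i - 1)) (p i) (p (j - 1)) (p j))"
  let ?T = "{p \<in> {0..?k} \<rightarrow>\<^sub>E {1..int n}. ?Q p}"
  let ?f = "\<lambda>\<pi>. restrict (\<lambda>i. int (\<pi> i)) {0..?k}" and ?g = "\<lambda>p. restrict (\<lambda>i. nat (p i)) {0..?k}"
  have len: "length w = ?k" using w by (simp add: CW2_def)
  have "\<forall>i\<in>{1..length w}. \<forall>j\<in>{1..length w}. w ! (i - 1) = w ! (j - 1) \<longrightarrow>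
      c ! (i - 1) = c ! (j - 1)"
    using w unfolding CW2_def by blast
  then have color: "c ! (i - 1) = c ! (j - 1)"
    if "i \<in> {1..?k}" "j \<in> {1..?k}" "w ! (i - 1) = w ! (j - 1)" for i j
    using that unfolding len by blast
  have Q: "?Q (?f \<pi>) \<longleftrightarrow> \<pi> \<in> Pi_C_star L c w n" if \<pi>: "\<pi> \<in> {0..?k} \<rightarrow>\<^sub>E {1..n}" for \<pi>
  proof -
    have "c ! (i - 1) = c ! (j - 1) \<and>
        L (c ! (i - 1)) n (\<pi> (i - 1)) (\<pi> i) = L (c ! (j - 1)) n (\<pi> (j - 1)) (\<pi> j) \<longleftrightarrow>
        E (c ! (i - 1)) n (?f \<pi> (i - 1)) (?f \<pi> i) (?f \<pi> (j - 1)) (?f \<pi> j)"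
      if ij: "i \<in> {1..?k}" "j \<in> {1..?k}" "w ! (i - 1) = w ! (j - 1)" for i j
    proof -
      have "c ! (i - 1) \<in> {1, 2}"
        by (rule subsetD[OF c nth_mem]) (use ij in auto)
      from E[OF this] have link: "linear_link (L (c ! (i - 1))) (E (c ! (i - 1))) (F (c ! (i - 1)))" .
      have \<pi>n: "\<pi> l \<in> {1..n}" if "l \<in> {0..?k}" for l
        using \<pi> that by (rule PiE_mem)
      have k: "i - 1 \<in> {0..?k}" "i \<in> {0..?k}" "j - 1 \<in> {0..?k}" "j \<in> {0..?k}" using ij by auto
      show ?thesis
        using linear_link_eq[OF link k[THEN \<pi>n]] color[OF ij] by (simp only: k restrict_apply' simp_thms)
    qed
    then have eq1: "(\<forall>i\<in>{1..?k}. \<forall>j\<in>{1..?k}. w ! (i - 1) = w ! (j - 1) \<longrightarrow>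
        E (c ! (i - 1)) n (?f \<pi> (i - 1)) (?f \<pi> i) (?f \<pi> (j - 1)) (?f \<pi> j)) \<longleftrightarrow>
      (\<forall>i\<in>{1..?k}. \<forall>j\<in>{1..?k}. w ! (i - 1) = w ! (j - 1) \<longrightarrow>
        c ! (i - 1) = c ! (j - 1) \<and>
        L (c ! (i - 1)) n (\<pi> (i - 1)) (\<pi> i) = L (c ! (j - 1)) n (\<pi> (j - 1)) (\<pi> j))"
      by blast
    have eq0: "?f \<pi> 0 = ?f \<pi> ?k \<longleftrightarrow> \<pi> 0 = \<pi> ?k" by simp
    show ?thesis
      unfolding Pi_C_star_def circuits_def mem_Collect_eq eq0 eq1 using \<pi> by blast
  qed
  have sub: "Pi_C_star L c w n \<subseteq> {0..?k} \<rightarrow>\<^sub>E {1..n}"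
    by (auto simp: Pi_C_star_def circuits_def)
  have gf: "?g (?f \<pi>) = \<pi>" if "\<pi> \<in> {0..?k} \<rightarrow>\<^sub>E {1..n}" for \<pi>
    using that by (auto simp: PiE_iff extensional_def)
  have fg: "?f (?g p) = p" if "p \<in> {0..?k} \<rightarrow>\<^sub>E {1..int n}" for p
    using that by (force simp: PiE_iff extensional_def)
  show "\<forall>\<pi>\<in>Pi_C_star L c w n. ?g (?f \<pi>) = \<pi>" using gf sub by blast
  show "\<forall>p\<in>?T. ?f (?g p) = p" using fg by blast
  show "?f ` Pi_C_star L c w n \<subseteq> ?T"
  proof (rule image_subsetI)
    fix \<pi> assume \<pi>: "\<pi> \<in> Pi_C_star L c w n"
    then have "\<pi> \<in> {0..?k} \<rightarrow>\<^sub>E {1..n}" using sub by blast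
    then have "?f \<pi> \<in> {0..?k} \<rightarrow>\<^sub>E {1..int n}" "?Q (?f \<pi>)"
    proof -
      show "?f \<pi> \<in> {0..?k} \<rightarrow>\<^sub>E {1..int n}"
        using \<open>\<pi> \<in> {0..?k} \<rightarrow>\<^sub>E {1..n}\<close> by (force simp: PiE_iff)
    qed (use Q[OF \<open>\<pi> \<in> {0..?k} \<rightarrow>\<^sub>E {1..n}\<close>] \<pi> in blast)+
    then show "?f \<pi> \<in> ?T" by blast
  qed
  show "?g ` ?T \<subseteq> Pi_C_star L c w n"
  proof (rule image_subsetI)
    fix p assume p: "p \<in> ?T"
    then have gp: "?g p \<in> {0..?k} \<rightarrow>\<^sub>E {1..n}" by (force simp: PiE_iff)
    have "?f (?g p) = p" using p fg by blast
    moreover have "?Q p" using p by blast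
    ultimately have "?Q (?f (?g p))" by (rule ssubst[where P = ?Q])
    then show "?g p \<in> Pi_C_star L c w n" by (rule Q[OF gp, THEN iffD1])
  qed
qed

section \<open>Counting the second occurrences of letters\<close>

definition second_occurrences :: "nat list \<Rightarrow> nat set" where
  "second_occurrences w = {j \<in> {1..length w}. \<exists>i\<in>{1..<j}. w ! (i - 1) = w ! (j - 1)}"

text \<open>The positions split into pairs, one for each letter, and exactly the later member of a
  pair is a second occurrence. Hence second occurrences are in bijection with letters.\<close>

lemma length_eq_twice_second_occurrences:
  assumes "\<forall>a\<in>set w. card {i \<in> {1..length w}. w ! (i - 1) = a} = 2"
  shows "length w = 2 * card (second_occurrences w)"
proof -
  let ?C = "\<lambda>a. {i \<in> {1..length w}. w ! (i - 1) = a}"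
  have mem: "w ! (i - 1) \<in> set w" if "i \<in> {1..length w}" for i
    using that by (intro nth_mem) auto
  have "{1..length w} = (\<Union>a\<in>set w. ?C a)" using mem by auto
  then have "length w = card (\<Union>a\<in>set w. ?C a)" by (metis card_atLeastAtMost diff_Suc_1)
  also have "\<dots> = (\<Sum>a\<in>set w. card (?C a))"
    by (rule card_UN_disjoint) auto
  also have "\<dots> = 2 * card (set w)" using assms by simp
  also have "bij_betw (\<lambda>j. w ! (j - 1)) (second_occurrences w) (set w)"
  proof (rule bij_betw_imageI)
    \<comment> \<open>Two distinct second occurrences of one letter, with the position preceding the
      smaller one, would give that letter three positions.\<close>
    have no_three: False
      if "l \<in> ?C a" "i \<in> ?C a" "j \<in> ?C a" "l < i" "i < j" for a l i j
    proof -
      have "{l, i, j} \<subseteq> ?C a" using that by blast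
      then have "card {l, i, j} \<le> card (?C a)" by (rule card_mono[rotated]) simp
      moreover have "a \<in> set w" using that(1) mem by blast
      ultimately show False using assms that by simp
    qed
    show "inj_on (\<lambda>j. w ! (j - 1)) (second_occurrences w)"
    proof (rule linorder_inj_onI)
      fix i j assume ij: "i < j" "i \<in> second_occurrences w" "j \<in> second_occurrences w"
      then obtain l where "l \<in> {1..<i}" "w ! (l - 1) = w ! (i - 1)"
        by (auto simp: second_occurrences_def)
      then show "w ! (i - 1) \<noteq> w ! (j - 1)"
        using no_three[of l "w ! (j - 1)" i j] ij by (auto simp: second_occurrences_def)
    qed auto
    show "(\<lambda>j. w ! (j - 1)) ` second_occurrences w = set w"
    proof
      show "(\<lambda>j. w ! (j - 1)) ` second_occurrences w \<subseteq> set w"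
        using mem by (auto simp: second_occurrences_def)
      show "set w \<subseteq> (\<lambda>j. w ! (j - 1)) ` second_occurrences w"
      proof
        fix a assume "a \<in> set w"
        then obtain i j where "?C a = {i, j}" "i \<noteq> j"
          using assms by (metis (lifting) card_2_iff)
        then obtain i j where "?C a = {i, j}" "i < j"
          by (metis insert_commute linorder_neqE_nat)
        then have "i \<in> ?C a" "j \<in> ?C a" by blast+
        then have "j \<in> second_occurrences w" "w ! (j - 1) = a"
          using \<open>i < j\<close> by (auto simp: second_occurrences_def)
        then show "a \<in> (\<lambda>j. w ! (j - 1)) ` second_occurrences w" by blast
      qed
    qed
  qed
  then have "card (set w) = card (second_occurrences w)"
    by (rule bij_betw_same_card[symmetric])
  finally show ?thesis .
qed

theorem theorem3p2:
  fixes M :: "'a measure"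
    and L :: "nat \<Rightarrow> link"
    and x :: "nat \<Rightarrow> int list \<Rightarrow> 'a \<Rightarrow> real"
    and X Y :: "nat \<Rightarrow> 'a \<Rightarrow> real mat"
  assumes "prob_space M"
    and "L 1 \<in> five_links" and "L 2 \<in> five_links"
    and "\<And>n \<omega>. X n \<omega> = patterned_matrix (L 1) (x 1) n \<omega>"
    and "\<And>n \<omega>. Y n \<omega> = patterned_matrix (L 2) (x 2) n \<omega>"
    and "admissible_inputs M L x"
  shows "\<forall>c\<in>monomials. \<forall>w\<in>CW2 c.
    convergent (\<lambda>n. real (card (Pi_C_star L c w n)) / real n powr (1 + real (length c) / 2))"
proof (intro ballI)
  fix c w assume "c \<in> monomials" and w: "w \<in> CW2 c"
  then have c: "set c \<subseteq> {1, 2}" by (simp add: monomials_def)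
  have "\<forall>i\<in>{1, 2}. \<exists>E F. linear_link (L i) E F"
    using five_links_linear assms(2,3) by blast
  then obtain E F where EF: "\<And>i. i \<in> {1, 2} \<Longrightarrow> linear_link (L i) (E i) (F i)"
    by metis
  let ?k = "length c"
  let ?P = "\<lambda>p n. p 0 = p ?k \<and>
    (\<forall>i\<in>{1..?k}. \<forall>j\<in>{1..?k}. w ! (i - 1) = w ! (j - 1) \<longrightarrow>
      E (c ! (i - 1)) n (p (i - 1)) (p i) (p (j - 1)) (p j))"
  let ?D = "second_occurrences w"
  \<comment> \<open>All earlier positions \<open>i\<close> contribute candidates, whatever their
    letter; it suffices that the set is finite and contains the forms of the true partner. The
    indices \<open>i - 1\<close>, \<open>i\<close> and \<open>j - 1\<close> all lie below
    \<open>j\<close>, as the elimination demands.\<close>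
  let ?G = "\<lambda>j. (\<Union>i\<in>{1..<j}. (\<lambda>f p n. f n (p (i - 1)) (p i) (p (j - 1))) ` F (c ! (i - 1)))"
  have len: "length w = ?k" using w by (simp add: CW2_def)
  have "length w = 2 * card ?D"
    using w unfolding CW2_def by (intro length_eq_twice_second_occurrences) blast
  then have k: "?k = 2 * card ?D" by (simp add: len)
  have D: "?D \<subseteq> {1..?k}" by (auto simp: second_occurrences_def len)
  then have D0: "?D \<subseteq> {0..?k}" by auto
  have finD: "finite ?D" using D finite_subset by blast
  have link: "linear_link (L (c ! (i - 1))) (E (c ! (i - 1))) (F (c ! (i - 1)))" if "i \<in> {1..?k}" for i
    by (rule EF[OF subsetD[OF c nth_mem]]) (use that in auto)
  have "convergent (\<lambda>n. real (box_count {0..?k} ?P n) / real n ^ card ({0..?k} - ?D))"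
  proof (rule tame_density_determined[OF finD, where F = ?G])
    fix j assume j: "j \<in> ?D"
    then have jk: "j \<in> {1..?k}" using D by blast
    have "finite (F (c ! (i - 1)))" if "i \<in> {1..<j}" for i
      by (rule finite_linear_link[OF link]) (use that jk in auto)
    then show "finite (?G j)" by blast
    fix m assume "m \<in> ?G j"
    then obtain i f where i: "i \<in> {1..<j}" and f: "f \<in> F (c ! (i - 1))"
      and m: "m = (\<lambda>p n. f n (p (i - 1)) (p i) (p (j - 1)))" by blast
    show "lin ({0..?k} \<inter> {..<j}) m"
      unfolding m by (rule linear_link_lin[OF link f]) (use i jk in auto)
  next
    show "tame {0..?k} ?P"
    proof (intro tame.conj tame_eq lin_var tame_Ball tame_imp_const)
      fix i j assume "i \<in> {1..?k}" "j \<in> {1..?k}"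
      then show "tame {0..?k} (\<lambda>p n. E (c ! (i - 1)) n (p (i - 1)) (p i) (p (j - 1)) (p j))"
        by (intro linear_link_tame[OF link]) auto
    qed auto
  next
    fix n p j
    assume P: "?P p n" and "j \<in> ?D"
    then obtain i where i: "i \<in> {1..<j}" "w ! (i - 1) = w ! (j - 1)" and j: "j \<in> {1..?k}"
      by (auto simp: second_occurrences_def len)
    then have "i \<in> {1..?k}" by simp
    then have "E (c ! (i - 1)) n (p (i - 1)) (p i) (p (j - 1)) (p j)"
      using P i j by blast
    then obtain f where f: "f \<in> F (c ! (i - 1))" and pj: "p j = f n (p (i - 1)) (p i) (p (j - 1))"
      by (rule linear_link_solution[OF link[OF \<open>i \<in> {1..?k}\<close>]])
    show "\<exists>m\<in>?G j. p j = m p n"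
      by (rule bexI[where x = "\<lambda>p n. f n (p (i - 1)) (p i) (p (j - 1))"])
        (use pj f i(1) in blast)+
  qed (use D0 in auto)
  \<comment> \<open>Of the \<open>?k + 1\<close> positions, half of \<open>?k\<close> are second
    occurrences; position 0 is never one of them.\<close>
  moreover have "card ({0..?k} - ?D) = 1 + card ?D"
    using card_Diff_subset[OF finD D0] k by simp
  moreover have "card (Pi_C_star L c w n) = box_count {0..?k} ?P n" for n
    by (rule card_Pi_C_star[OF c w EF])
  ultimately have conv:
      "convergent (\<lambda>n. real (card (Pi_C_star L c w n)) / real n ^ (1 + card ?D))"
    by simp
  have exponent: "1 + real ?k / 2 = real (1 + card ?D)" using k by simp
  \<comment> \<open>\<open>powr_realpow\<close> asks for a positive base, so the two normalisations
    are compared for positive \<open>n\<close> only.\<close>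
  have "\<forall>\<^sub>F n in sequentially.
      real (card (Pi_C_star L c w n)) / real n ^ (1 + card ?D) =
      real (card (Pi_C_star L c w n)) / real n powr (1 + real ?k / 2)"
    using eventually_gt_at_top[of 0]
    by eventually_elim (simp only: exponent powr_realpow of_nat_0_less_iff)
  from convergent_cong[OF this] conv
  show "convergent (\<lambda>n. real (card (Pi_C_star L c w n)) / real n powr (1 + real ?k / 2))"
    by (rule iffD1)
qed

end
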